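(* Let $\mathscr S$ be a topos and $F\colon\mathbb C\to\mathbb D$ an internal functor in $\mathscr S$. Let $X$ be an internal diagram on $\mathbb D$ with structure map $\gamma\colon X\to D_0$, let $\phi\colon X\to\Omega_*$ be a morphism in $[\mathbb D,\mathscr S]$, and let $c\colon Z\to C_0$ and $a\colon Z\to X$ be morphisms of $\mathscr S$ with $\gamma a=F_0c$. Then $c\Vdash_*\phi(a)$ holds if and only if $d\Vdash_*\phi(f_!a)$ holds for all $f\colon c\to d$, that is, for all $f\colon Z\to C_1$ with $d_0f=c$ and $d_1f=d$.
   Context: An internal category $\mathbb C$ in $\mathscr S$ has object of objects $C_0$, object of arrows $C_1$, domain $d_0$ and codomain $d_1\colon C_1\to C_0$, identities $y\colon C_0\to C_1$ and composition $\otimes$. An internal functor $F\colon\mathbb C\to\mathbb D$ consists of $F_0\colon C_0\to D_0$, $F_1\colon C_1\to D_1$ commuting with all the structure. An internal diagram on $\mathbb C$ is a morphism $\gamma\colon X\to C_0$ with an action $m\colon X\times_{C_0}C_1\to X$ (pullback of $\gamma$ and $d_0$), with $\gamma m=d_1\pi_2$, that is associative and unital. Morphisms of internal diagrams are morphisms over $C_0$ commuting with the actions; they form a topos $[\mathbb C,\mathscr S]$ with terminal object $C_0$. $F$ induces a geometric morphism $[\mathbb C,\mathscr S]\to[\mathbb D,\mathscr S]$ with inverse image $F^*$ (pullback along $F_0$, with the action restricted along $F_1$) and direct image $F_*$. Write $\Omega$ for the subobject classifier of $[\mathbb C,\mathscr S]$, $\Omega_*=F_*\Omega$, and for $\phi\colon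 X\to\Omega_*$ in $[\mathbb D,\mathscr S]$ write $\overline\phi=\epsilon\circ F^*\phi\colon F^*X\to\Omega$ for its transpose under $F^*\dashv F_*$. For $\psi\colon Y\to\Omega$ in $[\mathbb C,\mathscr S]$, let $S_\psi\to Y$ be the pullback of $\top\colon 1\to\Omega$ along $\psi$. For $c\colon Z\to C_0$ and $b\colon Z\to Y$ over $C_0$, $c\Vdash\psi(b)$ means that $b$ factors through $S_\psi\to Y$ over $C_0$. Given $c\colon Z\to C_0$ and $a\colon Z\to X$ with $\gamma a=F_0c$, regard $a$ as the induced morphism $Z\to F^*X=C_0\times_{D_0}X$ over $C_0$; then $c\Vdash_*\phi(a)$ means $c\Vdash\overline\phi(a)$ in $[\mathbb C,\mathscr S]$. For $f\colon Z\to C_1$ with $d_0f=c$, $d_1f=d$, $f_!a:=m\langle a,F_1f\rangle\colon Z\to X$, a generalized element with $\gamma f_!a=F_0d$. *)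

theory Defs
  imports Main
begin

section \<open>Categories, functors, adjunctions\<close>

record ('o, 'a) category =
  Ob   :: "'o set"
  Ar   :: "'a set"
  Dom  :: "'a \<Rightarrow> 'o"
  Cod  :: "'a \<Rightarrow> 'o"
  Iden :: "'o \<Rightarrow> 'a"
  Comp :: "'a \<Rightarrow> 'a \<Rightarrow> 'a"  (infixr "\<cdot>\<index>" 75)

text \<open>Composition is written in the usual (right-to-left) order and is meaningful only on
  composable arrows.\<close>

definition hom :: "('o, 'a) category \<Rightarrow> 'o \<Rightarrow> 'o \<Rightarrow> 'a set" where
  "hom K X Y = {f \<in> Ar K. Dom K f = X \<and> Cod K f = Y}"

locale category =
  fixes K :: "('o, 'a) category" (structure)
  assumes dom_in [intro]: "f \<in> Ar K \<Longrightarrow> Dom K f \<in> Ob K"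
    and cod_in [intro]: "f \<in> Ar K \<Longrightarrow> Cod K f \<in> Ob K"
    and iden_hom [intro]: "X \<in> Ob K \<Longrightarrow> Iden K X \<in> hom K X X"
    and comp_hom [intro]: "f \<in> hom K X Y \<Longrightarrow> g \<in> hom K Y Z \<Longrightarrow> g \<cdot> f \<in> hom K X Z"
    and comp_iden: "f \<in> hom K X Y \<Longrightarrow> f \<cdot> Iden K X = f"
    and iden_comp: "f \<in> hom K X Y \<Longrightarrow> Iden K Y \<cdot> f = f"
    and comp_assoc: "f \<in> hom K W X \<Longrightarrow> g \<in> hom K X Y \<Longrightarrow> h \<in> hom K Y Z \<Longrightarrow>
                     (h \<cdot> g) \<cdot> f = h \<cdot> (g \<cdot> f)"

record ('o1, 'a1, 'o2, 'a2) functr =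
  Fob :: "'o1 \<Rightarrow> 'o2"
  Far :: "'a1 \<Rightarrow> 'a2"

locale cat_functor = A: category A + B: category B
  for A :: "('o1, 'a1) category" and B :: "('o2, 'a2) category" +
  fixes T :: "('o1, 'a1, 'o2, 'a2) functr"
  assumes fob_in: "X \<in> Ob A \<Longrightarrow> Fob T X \<in> Ob B"
    and far_hom: "f \<in> hom A X Y \<Longrightarrow> Far T f \<in> hom B (Fob T X) (Fob T Y)"
    and far_iden: "X \<in> Ob A \<Longrightarrow> Far T (Iden A X) = Iden B (Fob T X)"
    and far_comp: "f \<in> hom A X Y \<Longrightarrow> g \<in> hom A Y Z \<Longrightarrow>
                   Far T (g \<cdot>\<^bsub>A\<^esub> f) = Far T g \<cdot>\<^bsub>B\<^esub> Far T f"

text \<open>\<open>L : A \<rightarrow> B\<close> is left adjoint to \<open>R : B \<rightarrow> A\<close>, with unit \<open>\<eta>\<close> and counit \<open>\<epsilon>\<close>.\<close>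

locale adjunction = L: cat_functor A B L + R: cat_functor B A R
  for A :: "('o1, 'a1) category" and B :: "('o2, 'a2) category" and L R +
  fixes \<eta> :: "'o1 \<Rightarrow> 'a1" and \<epsilon> :: "'o2 \<Rightarrow> 'a2"
  assumes unit_hom: "X \<in> Ob A \<Longrightarrow> \<eta> X \<in> hom A X (Fob R (Fob L X))"
    and unit_natural: "f \<in> hom A X Y \<Longrightarrow> \<eta> Y \<cdot>\<^bsub>A\<^esub> f = Far R (Far L f) \<cdot>\<^bsub>A\<^esub> \<eta> X"
    and counit_hom: "U \<in> Ob B \<Longrightarrow> \<epsilon> U \<in> hom B (Fob L (Fob R U)) U"
    and counit_natural: "g \<in> hom B U V \<Longrightarrow> g \<cdot>\<^bsub>B\<^esub> \<epsilon> U = \<epsilon> V \<cdot>\<^bsub>B\<^esub> Far L (Far R g)"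
    and triangle_L: "X \<in> Ob A \<Longrightarrow> \<epsilon> (Fob L X) \<cdot>\<^bsub>B\<^esub> Far L (\<eta> X) = Iden B (Fob L X)"
    and triangle_R: "U \<in> Ob B \<Longrightarrow> Far R (\<epsilon> U) \<cdot>\<^bsub>A\<^esub> \<eta> (Fob R U) = Iden A (Fob R U)"


section \<open>Limits, exponentials, subobject classifiers, elementary toposes\<close>

definition is_terminal :: "('o, 'a) category \<Rightarrow> 'o \<Rightarrow> bool" where
  "is_terminal K T \<longleftrightarrow> T \<in> Ob K \<and> (\<forall>X\<in>Ob K. \<exists>!f. f \<in> hom K X T)"

definition is_product :: "('o, 'a) category \<Rightarrow> 'o \<Rightarrow> 'o \<Rightarrow> 'a \<Rightarrow> 'a \<Rightarrow> bool" where
  "is_product K X Y p q \<longleftrightarrow>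
     p \<in> hom K (Dom K p) X \<and> q \<in> hom K (Dom K p) Y \<and>
     (\<forall>Z u v. u \<in> hom K Z X \<and> v \<in> hom K Z Y \<longrightarrow>
        (\<exists>!w. w \<in> hom K Z (Dom K p) \<and> p \<cdot>\<^bsub>K\<^esub> w = u \<and> q \<cdot>\<^bsub>K\<^esub> w = v))"

text \<open>\<open>(p, q)\<close> is a pullback cone of the cospan \<open>(f, g)\<close>; \<open>p\<close> is the projection to the domain
  of \<open>f\<close>, \<open>q\<close> the one to the domain of \<open>g\<close>.\<close>

definition is_pullback :: "('o, 'a) category \<Rightarrow> 'a \<Rightarrow> 'a \<Rightarrow> 'a \<Rightarrow> 'a \<Rightarrow> bool" where
  "is_pullback K f g p q \<longleftrightarrow>
     f \<in> Ar K \<and> g \<in> Ar K \<and> Cod K f = Cod K g \<and>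
     p \<in> hom K (Dom K p) (Dom K f) \<and> q \<in> hom K (Dom K p) (Dom K g) \<and>
     f \<cdot>\<^bsub>K\<^esub> p = g \<cdot>\<^bsub>K\<^esub> q \<and>
     (\<forall>Z u v. u \<in> hom K Z (Dom K f) \<and> v \<in> hom K Z (Dom K g) \<and> f \<cdot>\<^bsub>K\<^esub> u = g \<cdot>\<^bsub>K\<^esub> v \<longrightarrow>
        (\<exists>!w. w \<in> hom K Z (Dom K p) \<and> p \<cdot>\<^bsub>K\<^esub> w = u \<and> q \<cdot>\<^bsub>K\<^esub> w = v))"

definition is_mono :: "('o, 'a) category \<Rightarrow> 'a \<Rightarrow> bool" where
  "is_mono K m \<longleftrightarrow> m \<in> Ar K \<and>
     (\<forall>Z u v. u \<in> hom K Z (Dom K m) \<and> v \<in> hom K Z (Dom K m) \<and> m \<cdot>\<^bsub>K\<^esub> u = m \<cdot>\<^bsub>K\<^esub> v \<longrightarrow> u = v)"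

text \<open>\<open>tr : 1 \<rightarrow> \<Omega>\<close> is a subobject classifier: every monomorphism is the pullback of \<open>tr\<close>
  along exactly one arrow.\<close>

definition is_subobject_classifier :: "('o, 'a) category \<Rightarrow> 'o \<Rightarrow> 'a \<Rightarrow> bool" where
  "is_subobject_classifier K \<Omega> tr \<longleftrightarrow>
     is_terminal K (Dom K tr) \<and> tr \<in> hom K (Dom K tr) \<Omega> \<and>
     (\<forall>m. is_mono K m \<longrightarrow>
        (\<exists>!\<chi>. \<chi> \<in> hom K (Cod K m) \<Omega> \<and> (\<exists>t. is_pullback K \<chi> tr m t)))"

text \<open>\<open>ev : E \<times> X \<rightarrow> Y\<close> exhibits \<open>E\<close> as the exponential \<open>Y\<^sup>X\<close>; here \<open>(p, q)\<close> are the
  projections of \<open>E \<times> X\<close>, and \<open>k\<close> is \<open>h \<times> X\<close>.\<close>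

definition is_exponential ::
    "('o, 'a) category \<Rightarrow> 'o \<Rightarrow> 'o \<Rightarrow> 'o \<Rightarrow> 'a \<Rightarrow> 'a \<Rightarrow> 'a \<Rightarrow> bool" where
  "is_exponential K X Y E p q ev \<longleftrightarrow>
     is_product K E X p q \<and> ev \<in> hom K (Dom K p) Y \<and>
     (\<forall>Z p' q' g. is_product K Z X p' q' \<and> g \<in> hom K (Dom K p') Y \<longrightarrow>
        (\<exists>!h. h \<in> hom K Z E \<and>
           (\<exists>k \<in> hom K (Dom K p') (Dom K p).
              p \<cdot>\<^bsub>K\<^esub> k = h \<cdot>\<^bsub>K\<^esub> p' \<and> q \<cdot>\<^bsub>K\<^esub> k = q' \<and> ev \<cdot>\<^bsub>K\<^esub> k = g)))"

locale topos = category S for S :: "('o, 'a) category" (structure) +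
  assumes has_terminal: "\<exists>T. is_terminal S T"
    and has_pullbacks: "f \<in> Ar S \<Longrightarrow> g \<in> Ar S \<Longrightarrow> Cod S f = Cod S g \<Longrightarrow> \<exists>p q. is_pullback S f g p q"
    and has_products: "X \<in> Ob S \<Longrightarrow> Y \<in> Ob S \<Longrightarrow> \<exists>p q. is_product S X Y p q"
    and has_exponentials:
      "X \<in> Ob S \<Longrightarrow> Y \<in> Ob S \<Longrightarrow> \<exists>E p q ev. is_exponential S X Y E p q ev"
    and has_subobject_classifier: "\<exists>\<Omega> tr. is_subobject_classifier S \<Omega> tr"

text \<open>A fixed choice of pullbacks: internal categories and diagrams carry operations whose
  domains are these chosen pullback objects.\<close>

definition pb :: "('o, 'a) category \<Rightarrow> 'a \<Rightarrow> 'a \<Rightarrow> 'a \<times> 'a" where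
  "pb K f g = (SOME (p, q). is_pullback K f g p q)"

definition pb1 :: "('o, 'a) category \<Rightarrow> 'a \<Rightarrow> 'a \<Rightarrow> 'a" where
  "pb1 K f g = fst (pb K f g)"

definition pb2 :: "('o, 'a) category \<Rightarrow> 'a \<Rightarrow> 'a \<Rightarrow> 'a" where
  "pb2 K f g = snd (pb K f g)"

definition pbob :: "('o, 'a) category \<Rightarrow> 'a \<Rightarrow> 'a \<Rightarrow> 'o" where
  "pbob K f g = Dom K (pb1 K f g)"

text \<open>The arrow \<open>\<langle>u, v\<rangle>\<close> into the chosen pullback of \<open>f\<close> and \<open>g\<close>, for \<open>f u = g v\<close>.\<close>

definition pair :: "('o, 'a) category \<Rightarrow> 'a \<Rightarrow> 'a \<Rightarrow> 'a \<Rightarrow> 'a \<Rightarrow> 'a" where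
  "pair K f g u v =
     (THE w. w \<in> hom K (Dom K u) (pbob K f g) \<and> pb1 K f g \<cdot>\<^bsub>K\<^esub> w = u \<and> pb2 K f g \<cdot>\<^bsub>K\<^esub> w = v)"


section \<open>Internal categories and internal functors\<close>

record ('o, 'a) icat =
  C0  :: 'o
  C1  :: 'o
  d0  :: 'a
  d1  :: 'a
  idn :: 'a
  ten :: 'a

text \<open>\<open>itens S C f g\<close> is the generalized arrow \<open>f \<otimes> g\<close> (first \<open>f\<close>, then \<open>g\<close>), for
  \<open>f, g : Z \<rightarrow> C\<^sub>1\<close> with \<open>d\<^sub>1 f = d\<^sub>0 g\<close>. The composition has domain
  \<open>C\<^sub>1 \<times>\<^bsub>C\<^sub>0\<^esub> C\<^sub>1\<close>, the pullback of \<open>d\<^sub>1\<close> and \<open>d\<^sub>0\<close>.\<close>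

definition itens :: "('o, 'a) category \<Rightarrow> ('o, 'a) icat \<Rightarrow> 'a \<Rightarrow> 'a \<Rightarrow> 'a" where
  "itens S C f g = ten C \<cdot>\<^bsub>S\<^esub> pair S (d1 C) (d0 C) f g"

text \<open>Unit and associativity laws are stated for generalized elements \<open>Z \<rightarrow> C\<^sub>1\<close>,
  \<open>Z\<close> arbitrary.\<close>

locale internal_category = topos S for S :: "('o, 'a) category" (structure) +
  fixes C :: "('o, 'a) icat"
  assumes C0_in: "C0 C \<in> Ob S"
    and C1_in: "C1 C \<in> Ob S"
    and d0_hom: "d0 C \<in> hom S (C1 C) (C0 C)"
    and d1_hom: "d1 C \<in> hom S (C1 C) (C0 C)"
    and idn_hom: "idn C \<in> hom S (C0 C) (C1 C)"
    and ten_hom: "ten C \<in> hom S (pbob S (d1 C) (d0 C)) (C1 C)"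
    and d0_idn: "d0 C \<cdot> idn C = Iden S (C0 C)"
    and d1_idn: "d1 C \<cdot> idn C = Iden S (C0 C)"
    and d0_ten: "d0 C \<cdot> ten C = d0 C \<cdot> pb1 S (d1 C) (d0 C)"
    and d1_ten: "d1 C \<cdot> ten C = d1 C \<cdot> pb2 S (d1 C) (d0 C)"
    and idn_ten: "f \<in> hom S Z (C1 C) \<Longrightarrow> itens S C (idn C \<cdot> d0 C \<cdot> f) f = f"
    and ten_idn: "f \<in> hom S Z (C1 C) \<Longrightarrow> itens S C f (idn C \<cdot> d1 C \<cdot> f) = f"
    and ten_assoc: "f \<in> hom S Z (C1 C) \<Longrightarrow> g \<in> hom S Z (C1 C) \<Longrightarrow> h \<in> hom S Z (C1 C) \<Longrightarrow>
        d1 C \<cdot> f = d0 C \<cdot> g \<Longrightarrow> d1 C \<cdot> g = d0 C \<cdot> h \<Longrightarrow>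
        itens S C (itens S C f g) h = itens S C f (itens S C g h)"

record 'a ifun =
  F0 :: 'a
  F1 :: 'a

locale internal_functor = C: internal_category S C + D: internal_category S D
  for S :: "('o, 'a) category" (structure) and C D :: "('o, 'a) icat" +
  fixes F :: "'a ifun"
  assumes F0_hom: "F0 F \<in> hom S (C0 C) (C0 D)"
    and F1_hom: "F1 F \<in> hom S (C1 C) (C1 D)"
    and F_d0: "d0 D \<cdot> F1 F = F0 F \<cdot> d0 C"
    and F_d1: "d1 D \<cdot> F1 F = F0 F \<cdot> d1 C"
    and F_idn: "F1 F \<cdot> idn C = idn D \<cdot> F0 F"
    and F_ten: "f \<in> hom S Z (C1 C) \<Longrightarrow> g \<in> hom S Z (C1 C) \<Longrightarrow> d1 C \<cdot> f = d0 C \<cdot> g \<Longrightarrow>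
                F1 F \<cdot> itens S C f g = itens S D (F1 F \<cdot> f) (F1 F \<cdot> g)"


section \<open>The category of internal diagrams\<close>

record ('o, 'a) idiag =
  dob  :: 'o
  dstr :: 'a
  dact :: 'a

text \<open>\<open>act S C X x f = m\<langle>x, f\<rangle>\<close>, for generalized elements \<open>x : Z \<rightarrow> X\<close> and \<open>f : Z \<rightarrow> C\<^sub>1\<close> with
  \<open>\<gamma> x = d\<^sub>0 f\<close>.\<close>

definition act :: "('o, 'a) category \<Rightarrow> ('o, 'a) icat \<Rightarrow> ('o, 'a) idiag \<Rightarrow> 'a \<Rightarrow> 'a \<Rightarrow> 'a" where
  "act S C X x f = dact X \<cdot>\<^bsub>S\<^esub> pair S (dstr X) (d0 C) x f"

definition internal_diagram ::
    "('o, 'a) category \<Rightarrow> ('o, 'a) icat \<Rightarrow> ('o, 'a) idiag \<Rightarrow> bool" where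
  "internal_diagram S C X \<longleftrightarrow>
     dob X \<in> Ob S \<and>
     dstr X \<in> hom S (dob X) (C0 C) \<and>
     dact X \<in> hom S (pbob S (dstr X) (d0 C)) (dob X) \<and>
     dstr X \<cdot>\<^bsub>S\<^esub> dact X = d1 C \<cdot>\<^bsub>S\<^esub> pb2 S (dstr X) (d0 C) \<and>
     (\<forall>Z. \<forall>x \<in> hom S Z (dob X). act S C X x (idn C \<cdot>\<^bsub>S\<^esub> dstr X \<cdot>\<^bsub>S\<^esub> x) = x) \<and>
     (\<forall>Z. \<forall>x \<in> hom S Z (dob X). \<forall>f \<in> hom S Z (C1 C). \<forall>g \<in> hom S Z (C1 C).
        dstr X \<cdot>\<^bsub>S\<^esub> x = d0 C \<cdot>\<^bsub>S\<^esub> f \<longrightarrow> d1 C \<cdot>\<^bsub>S\<^esub> f = d0 C \<cdot>\<^bsub>S\<^esub> g \<longrightarrow>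
        act S C X (act S C X x f) g = act S C X x (itens S C f g))"

text \<open>A morphism of diagrams remembers its source and target, since these are not determined by
  the underlying arrow of \<open>S\<close>.\<close>

record ('o, 'a) idmor =
  msrc :: "('o, 'a) idiag"
  mtgt :: "('o, 'a) idiag"
  mund :: 'a

definition diagram_morphism ::
    "('o, 'a) category \<Rightarrow> ('o, 'a) icat \<Rightarrow> ('o, 'a) idmor \<Rightarrow> bool" where
  "diagram_morphism S C h \<longleftrightarrow>
     internal_diagram S C (msrc h) \<and> internal_diagram S C (mtgt h) \<and>
     mund h \<in> hom S (dob (msrc h)) (dob (mtgt h)) \<and>
     dstr (mtgt h) \<cdot>\<^bsub>S\<^esub> mund h = dstr (msrc h) \<and>
     mund h \<cdot>\<^bsub>S\<^esub> dact (msrc h) =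
       act S C (mtgt h) (mund h \<cdot>\<^bsub>S\<^esub> pb1 S (dstr (msrc h)) (d0 C)) (pb2 S (dstr (msrc h)) (d0 C))"

definition Diag ::
    "('o, 'a) category \<Rightarrow> ('o, 'a) icat \<Rightarrow> (('o, 'a) idiag, ('o, 'a) idmor) category" where
  "Diag S C =
     \<lparr>Ob = {X. internal_diagram S C X},
      Ar = {h. diagram_morphism S C h},
      Dom = msrc,
      Cod = mtgt,
      Iden = (\<lambda>X. \<lparr>msrc = X, mtgt = X, mund = Iden S (dob X)\<rparr>),
      Comp = (\<lambda>h k. \<lparr>msrc = msrc k, mtgt = mtgt h, mund = mund h \<cdot>\<^bsub>S\<^esub> mund k\<rparr>)\<rparr>"


section \<open>The inverse image functor of an internal functor\<close>

text \<open>\<open>F\<^sup>*X = C\<^sub>0 \<times>\<^bsub>D\<^sub>0\<^esub> X\<close> over \<open>C\<^sub>0\<close> by the first projection, with the restricted action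
  \<open>((c, x), f) \<mapsto> (d\<^sub>1 f, m\<langle>x, F\<^sub>1 f\<rangle>)\<close>.\<close>

definition pull_ob ::
    "('o, 'a) category \<Rightarrow> ('o, 'a) icat \<Rightarrow> ('o, 'a) icat \<Rightarrow> 'a ifun \<Rightarrow>
     ('o, 'a) idiag \<Rightarrow> ('o, 'a) idiag" where
  "pull_ob S C D F X =
     (let str = pb1 S (F0 F) (dstr X); prX = pb2 S (F0 F) (dstr X);
          p = pb1 S str (d0 C); f = pb2 S str (d0 C)
      in \<lparr>dob = pbob S (F0 F) (dstr X),
          dstr = str,
          dact = pair S (F0 F) (dstr X)
                   (d1 C \<cdot>\<^bsub>S\<^esub> f)
                   (act S D X (prX \<cdot>\<^bsub>S\<^esub> p) (F1 F \<cdot>\<^bsub>S\<^esub> f))\<rparr>)"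

definition pull_ar ::
    "('o, 'a) category \<Rightarrow> ('o, 'a) icat \<Rightarrow> ('o, 'a) icat \<Rightarrow> 'a ifun \<Rightarrow>
     ('o, 'a) idmor \<Rightarrow> ('o, 'a) idmor" where
  "pull_ar S C D F h =
     \<lparr>msrc = pull_ob S C D F (msrc h),
      mtgt = pull_ob S C D F (mtgt h),
      mund = pair S (F0 F) (dstr (mtgt h))
               (pb1 S (F0 F) (dstr (msrc h)))
               (mund h \<cdot>\<^bsub>S\<^esub> pb2 S (F0 F) (dstr (msrc h)))\<rparr>"

definition inverse_image ::
    "('o, 'a) category \<Rightarrow> ('o, 'a) icat \<Rightarrow> ('o, 'a) icat \<Rightarrow> 'a ifun \<Rightarrow>
     (('o, 'a) idiag, ('o, 'a) idmor, ('o, 'a) idiag, ('o, 'a) idmor) functr" where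
  "inverse_image S C D F = \<lparr>Fob = pull_ob S C D F, Far = pull_ar S C D F\<rparr>"


section \<open>Forcing\<close>

text \<open>\<open>forces S C tr c \<psi> b\<close> is \<open>c \<tturnstile> \<psi>(b)\<close> for \<open>\<psi> : Y \<rightarrow> \<Omega>\<close> in \<open>[C, S]\<close>, \<open>c : Z \<rightarrow> C\<^sub>0\<close> and
  \<open>b : Z \<rightarrow> Y\<close> over \<open>C\<^sub>0\<close>. Here \<open>s : S\<^sub>\<psi> \<rightarrow> Y\<close> is the pullback of \<open>tr : 1 \<rightarrow> \<Omega>\<close> along
  \<open>\<psi>\<close>, formed in \<open>[C, S]\<close>; it is unique up to isomorphism, so that it does not matter which one is
  used. The factorization \<open>u\<close> through \<open>s\<close> is an arrow of \<open>S\<close> over \<open>C\<^sub>0\<close>.\<close>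

definition forces ::
    "('o, 'a) category \<Rightarrow> ('o, 'a) icat \<Rightarrow> ('o, 'a) idmor \<Rightarrow> 'a \<Rightarrow> ('o, 'a) idmor \<Rightarrow> 'a \<Rightarrow> bool" where
  "forces S C tr c \<psi> b \<longleftrightarrow>
     (\<exists>s t. is_pullback (Diag S C) \<psi> tr s t \<and>
        (\<exists>u \<in> hom S (Dom S b) (dob (msrc s)).
           dstr (msrc s) \<cdot>\<^bsub>S\<^esub> u = c \<and> mund s \<cdot>\<^bsub>S\<^esub> u = b))"

text \<open>The transpose \<open>\<epsilon> \<circ> F\<^sup>*\<phi>\<close> of \<open>\<phi> : X \<rightarrow> F\<^sub>*\<Omega>\<close>.\<close>

definition transpose ::
    "('o, 'a) category \<Rightarrow> ('o, 'a) icat \<Rightarrow> ('o, 'a) icat \<Rightarrow> 'a ifun \<Rightarrow>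
     (('o, 'a) idiag \<Rightarrow> ('o, 'a) idmor) \<Rightarrow> ('o, 'a) idiag \<Rightarrow> ('o, 'a) idmor \<Rightarrow> ('o, 'a) idmor" where
  "transpose S C D F \<epsilon> \<Omega> \<phi> = \<epsilon> \<Omega> \<cdot>\<^bsub>Diag S C\<^esub> Far (inverse_image S C D F) \<phi>"

text \<open>\<open>c \<tturnstile>\<^sub>* \<phi>(a)\<close>; the element \<open>a\<close> of \<open>X\<close> is regarded as the element \<open>\<langle>c, a\<rangle>\<close> of
  \<open>F\<^sup>*X = C\<^sub>0 \<times>\<^bsub>D\<^sub>0\<^esub> X\<close>, where \<open>X\<close> is the domain of \<open>\<phi>\<close>.\<close>

definition forces_star ::
    "('o, 'a) category \<Rightarrow> ('o, 'a) icat \<Rightarrow> ('o, 'a) icat \<Rightarrow> 'a ifun \<Rightarrow>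
     (('o, 'a) idiag \<Rightarrow> ('o, 'a) idmor) \<Rightarrow> ('o, 'a) idiag \<Rightarrow> ('o, 'a) idmor \<Rightarrow>
     'a \<Rightarrow> ('o, 'a) idmor \<Rightarrow> 'a \<Rightarrow> bool" where
  "forces_star S C D F \<epsilon> \<Omega> tr c \<phi> a \<longleftrightarrow>
     forces S C tr c (transpose S C D F \<epsilon> \<Omega> \<phi>) (pair S (F0 F) (dstr (msrc \<phi>)) c a)"

text \<open>The element \<open>f\<^sub>!a\<close>, for \<open>a : Z \<rightarrow> X\<close> with \<open>\<gamma> a = F\<^sub>0 d\<^sub>0 f\<close>.\<close>

definition push ::
    "('o, 'a) category \<Rightarrow> ('o, 'a) icat \<Rightarrow> 'a ifun \<Rightarrow> ('o, 'a) idiag \<Rightarrow> 'a \<Rightarrow> 'a \<Rightarrow> 'a" where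
  "push S D F X f a = act S D X a (F1 F \<cdot>\<^bsub>S\<^esub> f)"

end

theory Submission
  imports Defs
begin

text \<open>Forcing is monotone because the subobject \<open>S\<^sub>\<psi> \<rightarrow> F\<^sup>*X\<close> classified by
  \<open>\<psi> = \<epsilon> \<circ> F\<^sup>*\<phi>\<close> is taken in the category of diagrams, so that it carries an action of its own.

  If \<open>u : Z \<rightarrow> S\<^sub>\<psi>\<close> lies over the element \<open>\<langle>c, a\<rangle>\<close> of \<open>F\<^sup>*X\<close>, then for every
  \<open>f : c \<rightarrow> d\<close> the translate \<open>m\<langle>u, f\<rangle>\<close> is again an element of \<open>S\<^sub>\<psi>\<close>. It lies over the translate
  of \<open>\<langle>c, a\<rangle>\<close> by \<open>f\<close> (\<open>diagram_morphism_act\<close>), which is \<open>\<langle>d, f\<^sub>!a\<rangle>\<close> because the action on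
  \<open>F\<^sup>*X\<close> is the one on \<open>X\<close> restricted along \<open>F\<^sub>1\<close> (\<open>act_pull_ob\<close>).

  The converse is the case of the identity arrow \<open>f = y c\<close>: it satisfies
  \<open>d\<^sub>0 f = d\<^sub>1 f = c\<close>, and \<open>f\<^sub>!a = a\<close> since \<open>F\<close> preserves identities and the action is unital
  (\<open>push_idn\<close>).

  Equivariance of a morphism and the action on \<open>F\<^sup>*X\<close> are both given at generic elements, the
  projections of a pullback. Precomposition carries them to arbitrary generalized elements
  (\<open>pair_comp\<close>, \<open>act_comp\<close>).\<close>

section \<open>Generalized elements of chosen pullbacks\<close>

context topos
begin

lemma pb_is_pullback:
  assumes "f \<in> hom S A B" "g \<in> hom S A' B"
  shows "is_pullback S f g (pb1 S f g) (pb2 S f g)"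
proof -
  obtain p q where "is_pullback S f g p q"
    using has_pullbacks assms by (fastforce simp: hom_def)
  then have "case (p, q) of (p, q) \<Rightarrow> is_pullback S f g p q"
    by simp
  then have "case pb S f g of (p, q) \<Rightarrow> is_pullback S f g p q"
    unfolding pb_def by (rule someI)
  then show ?thesis
    by (simp add: pb1_def pb2_def case_prod_beta)
qed

lemma pb_homs:
  assumes "f \<in> hom S A B" "g \<in> hom S A' B"
  shows pb1_hom: "pb1 S f g \<in> hom S (pbob S f g) A"
    and pb2_hom: "pb2 S f g \<in> hom S (pbob S f g) A'"
    and pb_commutes: "f \<cdot> pb1 S f g = g \<cdot> pb2 S f g"
  using pb_is_pullback[OF assms] assms
  by (auto simp: is_pullback_def pbob_def hom_def)

lemma pair_ex1:
  assumes "f \<in> hom S A B" "g \<in> hom S A' B"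
    and "u \<in> hom S Z A" "v \<in> hom S Z A'" "f \<cdot> u = g \<cdot> v"
  shows "\<exists>!w. w \<in> hom S Z (pbob S f g) \<and> pb1 S f g \<cdot> w = u \<and> pb2 S f g \<cdot> w = v"
proof -
  have "Dom S f = A" "Dom S g = A'"
    using assms by (auto simp: hom_def)
  then show ?thesis
    using pb_is_pullback[OF assms(1,2)] assms(3-5)
    unfolding is_pullback_def pbob_def by blast
qed

lemma pair_props:
  assumes "f \<in> hom S A B" "g \<in> hom S A' B"
    and "u \<in> hom S Z A" "v \<in> hom S Z A'" "f \<cdot> u = g \<cdot> v"
  shows pair_hom: "pair S f g u v \<in> hom S Z (pbob S f g)"
    and pb1_pair: "pb1 S f g \<cdot> pair S f g u v = u"
    and pb2_pair: "pb2 S f g \<cdot> pair S f g u v = v"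
proof -
  have "Dom S u = Z"
    using assms by (simp add: hom_def)
  then show "pair S f g u v \<in> hom S Z (pbob S f g)"
    "pb1 S f g \<cdot> pair S f g u v = u" "pb2 S f g \<cdot> pair S f g u v = v"
    using theI'[OF pair_ex1[OF assms]] by (simp_all add: pair_def)
qed

lemma pair_unique:
  assumes "f \<in> hom S A B" "g \<in> hom S A' B"
    and "u \<in> hom S Z A" "v \<in> hom S Z A'" "f \<cdot> u = g \<cdot> v"
    and "w \<in> hom S Z (pbob S f g)" "pb1 S f g \<cdot> w = u" "pb2 S f g \<cdot> w = v"
  shows "w = pair S f g u v"
  using pair_ex1[OF assms(1-5)] pair_props[OF assms(1-5)] assms(6-8) by blast

lemma pair_comp:
  assumes "f \<in> hom S A B" "g \<in> hom S A' B"
    and "u \<in> hom S Z A" "v \<in> hom S Z A'" "f \<cdot> u = g \<cdot> v"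
    and "w \<in> hom S W Z"
  shows "pair S f g u v \<cdot> w = pair S f g (u \<cdot> w) (v \<cdot> w)"
proof (rule pair_unique[OF assms(1,2)])
  note P = pair_props[OF assms(1-5)]
  show "u \<cdot> w \<in> hom S W A" "v \<cdot> w \<in> hom S W A'"
    using assms by auto
  show "f \<cdot> (u \<cdot> w) = g \<cdot> (v \<cdot> w)"
    using comp_assoc[OF assms(6,3,1)] comp_assoc[OF assms(6,4,2)] assms(5) by simp
  show "pair S f g u v \<cdot> w \<in> hom S W (pbob S f g)"
    using P(1) assms(6) by auto
  show "pb1 S f g \<cdot> (pair S f g u v \<cdot> w) = u \<cdot> w"
    using comp_assoc[OF assms(6) P(1) pb1_hom[OF assms(1,2)]] P(2) by simp
  show "pb2 S f g \<cdot> (pair S f g u v \<cdot> w) = v \<cdot> w"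
    using comp_assoc[OF assms(6) P(1) pb2_hom[OF assms(1,2)]] P(3) by simp
qed

end

section \<open>The action on generalized elements\<close>

context internal_category
begin

lemma act_hom:
  assumes "internal_diagram S C X" "x \<in> hom S Z (dob X)" "f \<in> hom S Z (C1 C)"
    and "dstr X \<cdot> x = d0 C \<cdot> f"
  shows "act S C X x f \<in> hom S Z (dob X)"
proof -
  have X: "dstr X \<in> hom S (dob X) (C0 C)" "dact X \<in> hom S (pbob S (dstr X) (d0 C)) (dob X)"
    using assms(1) by (auto simp: internal_diagram_def)
  show ?thesis
    unfolding act_def by (rule comp_hom[OF pair_hom[OF X(1) d0_hom assms(2-4)] X(2)])
qed

lemma dstr_act:
  assumes "internal_diagram S C X" "x \<in> hom S Z (dob X)" "f \<in> hom S Z (C1 C)"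
    and "dstr X \<cdot> x = d0 C \<cdot> f"
  shows "dstr X \<cdot> act S C X x f = d1 C \<cdot> f"
proof -
  have X: "dstr X \<in> hom S (dob X) (C0 C)" "dact X \<in> hom S (pbob S (dstr X) (d0 C)) (dob X)"
    "dstr X \<cdot> dact X = d1 C \<cdot> pb2 S (dstr X) (d0 C)"
    using assms(1) by (auto simp: internal_diagram_def)
  note P = pair_props[OF X(1) d0_hom assms(2-4)]
  have "dstr X \<cdot> act S C X x f = (dstr X \<cdot> dact X) \<cdot> pair S (dstr X) (d0 C) x f"
    unfolding act_def using comp_assoc[OF P(1) X(2,1)] by simp
  also have "\<dots> = d1 C \<cdot> f"
    using comp_assoc[OF P(1) pb2_hom[OF X(1) d0_hom] d1_hom] X(3) P(3) by simp
  finally show ?thesis .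
qed

lemma act_comp:
  assumes "internal_diagram S C X" "x \<in> hom S Z (dob X)" "f \<in> hom S Z (C1 C)"
    and "dstr X \<cdot> x = d0 C \<cdot> f" and "w \<in> hom S W Z"
  shows "act S C X x f \<cdot> w = act S C X (x \<cdot> w) (f \<cdot> w)"
proof -
  have X: "dstr X \<in> hom S (dob X) (C0 C)" "dact X \<in> hom S (pbob S (dstr X) (d0 C)) (dob X)"
    using assms(1) by (auto simp: internal_diagram_def)
  show ?thesis
    unfolding act_def
    using comp_assoc[OF assms(5) pair_hom[OF X(1) d0_hom assms(2-4)] X(2)]
      pair_comp[OF X(1) d0_hom assms(2-5)] by simp
qed

text \<open>Equivariance is required of a diagram morphism only at the generic pair of an element and an
  arrow; every other pair is a pullback of that one.\<close>

lemma diagram_morphism_act: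
  assumes h: "diagram_morphism S C h"
    and x: "x \<in> hom S Z (dob (msrc h))" and f: "f \<in> hom S Z (C1 C)"
    and xf: "dstr (msrc h) \<cdot> x = d0 C \<cdot> f"
  shows "mund h \<cdot> act S C (msrc h) x f = act S C (mtgt h) (mund h \<cdot> x) f"
proof -
  let ?X = "msrc h" and ?Y = "mtgt h"
  let ?p = "pb1 S (dstr ?X) (d0 C)" and ?q = "pb2 S (dstr ?X) (d0 C)"
  let ?w = "pair S (dstr ?X) (d0 C) x f"
  have X: "dstr ?X \<in> hom S (dob ?X) (C0 C)" "dact ?X \<in> hom S (pbob S (dstr ?X) (d0 C)) (dob ?X)"
    and Y: "internal_diagram S C ?Y" "dstr ?Y \<in> hom S (dob ?Y) (C0 C)"
    and m: "mund h \<in> hom S (dob ?X) (dob ?Y)" "dstr ?Y \<cdot> mund h = dstr ?X"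
      "mund h \<cdot> dact ?X = act S C ?Y (mund h \<cdot> ?p) ?q"
    using h by (auto simp: diagram_morphism_def internal_diagram_def)
  note w = pair_props[OF X(1) d0_hom x f xf]
  note p = pb1_hom[OF X(1) d0_hom] and q = pb2_hom[OF X(1) d0_hom]
  have over: "dstr ?Y \<cdot> (mund h \<cdot> ?p) = d0 C \<cdot> ?q"
    using comp_assoc[OF p m(1) Y(2)] m(2) pb_commutes[OF X(1) d0_hom] by simp
  have "mund h \<cdot> act S C ?X x f = (mund h \<cdot> dact ?X) \<cdot> ?w"
    unfolding act_def using comp_assoc[OF w(1) X(2) m(1)] by simp
  also have "\<dots> = act S C ?Y ((mund h \<cdot> ?p) \<cdot> ?w) (?q \<cdot> ?w)"
    unfolding m(3) by (rule act_comp[OF Y(1) comp_hom[OF p m(1)] q over w(1)])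
  also have "\<dots> = act S C ?Y (mund h \<cdot> x) f"
    using comp_assoc[OF w(1) p m(1)] w(2,3) by simp
  finally show ?thesis .
qed

end

section \<open>Restriction along the internal functor\<close>

context internal_functor
begin

lemma F1_over:
  assumes "f \<in> hom S Z (C1 C)"
    and "dstr X \<cdot> x = F0 F \<cdot> (d0 C \<cdot> f)"
  shows "dstr X \<cdot> x = d0 D \<cdot> (F1 F \<cdot> f)"
  using assms(2) C.comp_assoc[OF assms(1) C.d0_hom F0_hom]
    C.comp_assoc[OF assms(1) F1_hom D.d0_hom] F_d0 by simp

text \<open>The formula \<open>\<langle>d\<^sub>0 f, a\<rangle> \<cdot> f = \<langle>d\<^sub>1 f, f\<^sub>!a\<rangle>\<close> for the action on \<open>F\<^sup>*X\<close>: its values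
  at generic elements define that action.\<close>

lemma act_pull_ob:
  assumes X: "internal_diagram S D X"
    and a: "a \<in> hom S Z (dob X)" and f: "f \<in> hom S Z (C1 C)"
    and af: "dstr X \<cdot> a = F0 F \<cdot> (d0 C \<cdot> f)"
  shows "act S C (pull_ob S C D F X) (pair S (F0 F) (dstr X) (d0 C \<cdot> f) a) f =
    pair S (F0 F) (dstr X) (d1 C \<cdot> f) (push S D F X f a)"
proof -
  let ?str = "pb1 S (F0 F) (dstr X)" and ?prX = "pb2 S (F0 F) (dstr X)"
  let ?p = "pb1 S ?str (d0 C)" and ?q = "pb2 S ?str (d0 C)"
  let ?b = "pair S (F0 F) (dstr X) (d0 C \<cdot> f) a"
  let ?w = "pair S ?str (d0 C) ?b f"
  have dstr: "dstr X \<in> hom S (dob X) (C0 D)"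
    using X by (auto simp: internal_diagram_def)
  note str = C.pb1_hom[OF F0_hom dstr] and prX = C.pb2_hom[OF F0_hom dstr]
    and sq = C.pb_commutes[OF F0_hom dstr]
  note p = C.pb1_hom[OF str C.d0_hom] and q = C.pb2_hom[OF str C.d0_hom]
    and sq' = C.pb_commutes[OF str C.d0_hom]
  note b = C.pair_props[OF F0_hom dstr C.comp_hom[OF f C.d0_hom] a af[symmetric]]
  note w = C.pair_props[OF str C.d0_hom b(1) f b(2)]
  note prXp = C.comp_hom[OF p prX] and F1q = C.comp_hom[OF q F1_hom]
  have generic: "dstr X \<cdot> (?prX \<cdot> ?p) = d0 D \<cdot> (F1 F \<cdot> ?q)"
  proof (rule F1_over[OF q])
    show "dstr X \<cdot> (?prX \<cdot> ?p) = F0 F \<cdot> (d0 C \<cdot> ?q)"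
      using C.comp_assoc[OF p prX dstr] C.comp_assoc[OF p str F0_hom] sq sq' by simp
  qed
  have commutes: "F0 F \<cdot> (d1 C \<cdot> ?q) = dstr X \<cdot> act S D X (?prX \<cdot> ?p) (F1 F \<cdot> ?q)"
    using D.dstr_act[OF X prXp F1q generic]
      C.comp_assoc[OF q C.d1_hom F0_hom] C.comp_assoc[OF q F1_hom D.d1_hom] F_d1 by simp
  have "act S C (pull_ob S C D F X) ?b f =
      pair S (F0 F) (dstr X) (d1 C \<cdot> ?q) (act S D X (?prX \<cdot> ?p) (F1 F \<cdot> ?q)) \<cdot> ?w"
    by (simp add: act_def pull_ob_def Let_def)
  also have "\<dots> = pair S (F0 F) (dstr X) ((d1 C \<cdot> ?q) \<cdot> ?w)
      (act S D X (?prX \<cdot> ?p) (F1 F \<cdot> ?q) \<cdot> ?w)"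
    by (rule C.pair_comp[OF F0_hom dstr C.comp_hom[OF q C.d1_hom]
          D.act_hom[OF X prXp F1q generic] commutes w(1)])
  also have "(d1 C \<cdot> ?q) \<cdot> ?w = d1 C \<cdot> f"
    using C.comp_assoc[OF w(1) q C.d1_hom] w(3) by simp
  also have "act S D X (?prX \<cdot> ?p) (F1 F \<cdot> ?q) \<cdot> ?w =
      act S D X ((?prX \<cdot> ?p) \<cdot> ?w) ((F1 F \<cdot> ?q) \<cdot> ?w)"
    by (rule D.act_comp[OF X prXp F1q generic w(1)])
  also have "(?prX \<cdot> ?p) \<cdot> ?w = a"
    using C.comp_assoc[OF w(1) p prX] w(2) b(3) by simp
  also have "(F1 F \<cdot> ?q) \<cdot> ?w = F1 F \<cdot> f"
    using C.comp_assoc[OF w(1) q F1_hom] w(3) by simp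
  finally show ?thesis
    by (simp add: push_def)
qed

lemma push_idn:
  assumes X: "internal_diagram S D X"
    and a: "a \<in> hom S Z (dob X)" and c: "c \<in> hom S Z (C0 C)"
    and ac: "dstr X \<cdot> a = F0 F \<cdot> c"
  shows "push S D F X (idn C \<cdot> c) a = a"
proof -
  have "F1 F \<cdot> (idn C \<cdot> c) = (idn D \<cdot> F0 F) \<cdot> c"
    using C.comp_assoc[OF c C.idn_hom F1_hom] F_idn by simp
  also have "\<dots> = idn D \<cdot> (dstr X \<cdot> a)"
    using C.comp_assoc[OF c F0_hom D.idn_hom] ac by simp
  finally show ?thesis
    using X a by (auto simp: push_def internal_diagram_def)
qed

section \<open>Forcing\<close>

text \<open>Translating the witness \<open>u : Z \<rightarrow> S\<^sub>\<psi>\<close> by \<open>f\<close> gives a witness for \<open>f\<^sub>!a\<close>.\<close>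

lemma forces_star_push:
  assumes \<phi>: "internal_diagram S D (msrc \<phi>)"
    and a: "a \<in> hom S Z (dob (msrc \<phi>))" and f: "f \<in> hom S Z (C1 C)"
    and af: "dstr (msrc \<phi>) \<cdot> a = F0 F \<cdot> (d0 C \<cdot> f)"
    and forced: "forces_star S C D F \<epsilon> \<Omega> tr (d0 C \<cdot> f) \<phi> a"
  shows "forces_star S C D F \<epsilon> \<Omega> tr (d1 C \<cdot> f) \<phi> (push S D F (msrc \<phi>) f a)"
proof -
  let ?X = "msrc \<phi>" and ?\<psi> = "transpose S C D F \<epsilon> \<Omega> \<phi>"
  let ?b = "pair S (F0 F) (dstr ?X) (d0 C \<cdot> f) a"
  let ?b' = "pair S (F0 F) (dstr ?X) (d1 C \<cdot> f) (push S D F ?X f a)"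
  have dstr: "dstr ?X \<in> hom S (dob ?X) (C0 D)"
    using \<phi> by (auto simp: internal_diagram_def)
  have b: "?b \<in> hom S Z (pbob S (F0 F) (dstr ?X))"
    by (rule C.pair_hom[OF F0_hom dstr C.comp_hom[OF f C.d0_hom] a af[symmetric]])
  then have "Dom S ?b = Z"
    by (simp add: hom_def)
  with forced have "\<exists>s t. is_pullback (Diag S C) ?\<psi> tr s t \<and>
      (\<exists>u \<in> hom S Z (dob (msrc s)). dstr (msrc s) \<cdot> u = d0 C \<cdot> f \<and> mund s \<cdot> u = ?b)"
    by (simp only: forces_star_def forces_def)
  then obtain s t u where pb: "is_pullback (Diag S C) ?\<psi> tr s t"
    and u: "u \<in> hom S Z (dob (msrc s))" "dstr (msrc s) \<cdot> u = d0 C \<cdot> f" "mund s \<cdot> u = ?b"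
    by (elim exE conjE bexE) (rule that)
  have "Dom (Diag S C) ?\<psi> = pull_ob S C D F ?X"
    by (simp add: Diag_def transpose_def inverse_image_def pull_ar_def)
  moreover have "s \<in> hom (Diag S C) (Dom (Diag S C) s) (Dom (Diag S C) ?\<psi>)"
    using pb unfolding is_pullback_def by (elim conjE)
  ultimately have "s \<in> hom (Diag S C) (Dom (Diag S C) s) (pull_ob S C D F ?X)"
    by (simp only:)
  then have s: "diagram_morphism S C s" and tgt: "mtgt s = pull_ob S C D F ?X"
    by (simp_all add: hom_def Diag_def)
  have src: "internal_diagram S C (msrc s)"
    and m: "mund s \<in> hom S (dob (msrc s)) (dob (mtgt s))"
    using s by (auto simp: diagram_morphism_def)
  let ?u = "act S C (msrc s) u f"
  have u': "?u \<in> hom S Z (dob (msrc s))"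
    by (rule C.act_hom[OF src u(1) f u(2)])
  have over: "mund s \<cdot> ?u = ?b'"
    using C.diagram_morphism_act[OF s u(1) f u(2)] u(3) tgt act_pull_ob[OF \<phi> a f af] by simp
  have "Dom S ?b' = Z"
    using C.comp_hom[OF u' m] over by (simp add: hom_def)
  moreover have "dstr (msrc s) \<cdot> ?u = d1 C \<cdot> f"
    by (rule C.dstr_act[OF src u(1) f u(2)])
  ultimately show ?thesis
    unfolding forces_star_def forces_def using pb u' over
    by (intro exI[of _ s] exI[of _ t] conjI bexI[of _ ?u]) simp_all
qed

end

theorem theorem7p8:
  fixes S :: "('o, 'a) category"
    and C D :: "('o, 'a) icat"
    and F :: "'a ifun"
    and F_dir :: "(('o, 'a) idiag, ('o, 'a) idmor, ('o, 'a) idiag, ('o, 'a) idmor) functr"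
    and \<eta> \<epsilon> :: "('o, 'a) idiag \<Rightarrow> ('o, 'a) idmor"
    and \<Omega> X :: "('o, 'a) idiag"
    and tr \<phi> :: "('o, 'a) idmor"
    and Z :: 'o
    and c a :: 'a
  assumes "topos S"
    and "internal_category S C"
    and "internal_category S D"
    and "internal_functor S C D F"
    and "adjunction (Diag S D) (Diag S C) (inverse_image S C D F) F_dir \<eta> \<epsilon>"
    and "is_subobject_classifier (Diag S C) \<Omega> tr"
    and "X \<in> Ob (Diag S D)"
    and "\<phi> \<in> hom (Diag S D) X (Fob F_dir \<Omega>)"
    and "c \<in> hom S Z (C0 C)"
    and "a \<in> hom S Z (dob X)"
    and "dstr X \<cdot>\<^bsub>S\<^esub> a = F0 F \<cdot>\<^bsub>S\<^esub> c"
  shows "forces_star S C D F \<epsilon> \<Omega> tr c \<phi> a \<longleftrightarrow>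
    (\<forall>d f. f \<in> hom S Z (C1 C) \<and> d0 C \<cdot>\<^bsub>S\<^esub> f = c \<and> d1 C \<cdot>\<^bsub>S\<^esub> f = d \<longrightarrow>
       forces_star S C D F \<epsilon> \<Omega> tr d \<phi> (push S D F X f a))"
proof -
  interpret internal_functor S C D F by fact
  have X: "internal_diagram S D X" and \<phi>: "msrc \<phi> = X"
    using assms(7,8) by (auto simp: Diag_def hom_def)
  note c = \<open>c \<in> hom S Z (C0 C)\<close> and a = \<open>a \<in> hom S Z (dob X)\<close>
    and ac = \<open>dstr X \<cdot>\<^bsub>S\<^esub> a = F0 F \<cdot>\<^bsub>S\<^esub> c\<close>
  show ?thesis
  proof (intro iffI allI impI)
    fix d f
    assume "forces_star S C D F \<epsilon> \<Omega> tr c \<phi> a"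
      and "f \<in> hom S Z (C1 C) \<and> d0 C \<cdot>\<^bsub>S\<^esub> f = c \<and> d1 C \<cdot>\<^bsub>S\<^esub> f = d"
    then show "forces_star S C D F \<epsilon> \<Omega> tr d \<phi> (push S D F X f a)"
      using forces_star_push[of \<phi> a Z f] X \<phi> a ac by auto
  next
    assume all: "\<forall>d f. f \<in> hom S Z (C1 C) \<and> d0 C \<cdot>\<^bsub>S\<^esub> f = c \<and> d1 C \<cdot>\<^bsub>S\<^esub> f = d \<longrightarrow>
       forces_star S C D F \<epsilon> \<Omega> tr d \<phi> (push S D F X f a)"
    have "idn C \<cdot>\<^bsub>S\<^esub> c \<in> hom S Z (C1 C)"
      by (rule C.comp_hom[OF c C.idn_hom])
    moreover have "d0 C \<cdot>\<^bsub>S\<^esub> (idn C \<cdot>\<^bsub>S\<^esub> c) = c" "d1 C \<cdot>\<^bsub>S\<^esub> (idn C \<cdot>\<^bsub>S\<^esub> c) = c"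
      using C.comp_assoc[OF c C.idn_hom C.d0_hom] C.comp_assoc[OF c C.idn_hom C.d1_hom]
        C.d0_idn C.d1_idn C.iden_comp[OF c] by simp_all
    ultimately have "forces_star S C D F \<epsilon> \<Omega> tr c \<phi> (push S D F X (idn C \<cdot>\<^bsub>S\<^esub> c) a)"
      using all by blast
    then show "forces_star S C D F \<epsilon> \<Omega> tr c \<phi> a"
      by (simp add: push_idn[OF X a c ac])
  qed
qed

end
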